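(* Let $g,q,z_d\in\mathbb{R}$ and $M_3>0$. Let $b_{op}$ be the minimizer of $J_3$ over $\mathbb{R}$ and, for $h=x_0/n$ with $n\ge1$ an integer, let $b^h_{op}$ be the minimizer of $J_3^h$ over $\mathbb{R}$. (a) $$b^h_{op}=b_{op}+E_1gx_0h\left(1+\frac h{3x_0}\right),\qquad E_1=\frac1{4\left(1+\frac{M_3}{x_0}\right)}.$$ (b) There are constants $C_{13},C_{14}$ not depending on $h$ such that, as $h\to0$ ($h=x_0/n$, $n\to\infty$), $$|b^h_{op}-b_{op}|=C_{13}h+o(h),\qquad|J_3^h(b^h_{op})-J_3(b_{op})|=C_{14}h+o(h).$$
   Context: Fix $x_0,y_0>0$, $\Omega=(0,x_0)\times(0,y_0)$, $\Gamma_1=\{0\}\times(0,y_0]$, $H=L^2(\Omega)$ with its standard norm, $B=H^{1/2}(\Gamma_1)$. For constants $g,q,b\in\mathbb{R}$, the system $-\Delta u=g$ in $\Omega$, $u=b$ on $\Gamma_1$, $-\partial u/\partial n=q$ on $\{x_0\}\times(0,y_0]$, $-\partial u/\partial n=0$ on $[0,x_0]\times\{0,y_0\}$ has solution $u_b(x,y)=-\tfrac12gx^2+(gx_0-q)x+b$. For an integer $n\ge1$, $h=x_0/n$, $x_i=(i-1)h$, its discrete (finite-difference, piecewise linear) approximation is $u^h_b(x,y)=(gx_0-q-hgi)x+h^2g\tfrac{i(i-1)}2+b$ for $x\in[x_i,x_{i+1}]$, $y\in[0,y_0]$, $i=1,\dots,n$. For fixed $g,q,z_d\in\mathbb{R}$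 and $M_3>0$ the cost functions on $\mathbb{R}$ are $J_3(b)=\tfrac12\|u_b-z_d\|_H^2+\tfrac{M_3}2\|b\|_B^2$ and $J^h_3(b)=\tfrac12\|u^h_b-z_d\|_H^2+\tfrac{M_3}2\|b\|_B^2$, where $\|b\|_B^2=y_0b^2$ for constant $b$. The minimizer of $J_3$ is $b_{op}=\left(-\tfrac{gx_0^2}3+\tfrac{qx_0}2+z_d\right)\Big/\left(1+\tfrac{M_3}{x_0}\right)$. *)

theory Defs
  imports "HOL-Analysis.Analysis" "HOL-Library.Landau_Symbols"
begin

definition Omega :: "real \<Rightarrow> real \<Rightarrow> (real \<times> real) set" where
  "Omega x0 y0 = {0<..<x0} \<times> {0<..<y0}"

definition norm_H :: "real \<Rightarrow> real \<Rightarrow> (real \<times> real \<Rightarrow> real) \<Rightarrow> real" where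
  "norm_H x0 y0 v = sqrt (LINT p:Omega x0 y0|lborel. (v p)\<^sup>2)"

text \<open>The Sobolev--Slobodeckij norm of $H^{1/2}(\Gamma_1)$, with $\Gamma_1 = \{0\} \times (0,y_0]$
  parametrised by its second coordinate. On constants it takes the value
  $\|b\|_B^2 = y_0 b^2$, see \<open>norm_B_const\<close>. (On the diagonal, a null set, the difference
  quotient is $0$.)\<close>

definition norm_B :: "real \<Rightarrow> (real \<Rightarrow> real) \<Rightarrow> real" where
  "norm_B y0 v = sqrt ((LINT t:{0<..y0}|lborel. (v t)\<^sup>2)
     + (LINT p:{0<..y0} \<times> {0<..y0}|lborel. ((v (fst p) - v (snd p)) / (fst p - snd p))\<^sup>2))"

lemma norm_B_const:
  assumes "y0 > 0"
  shows "(norm_B y0 (\<lambda>_. b))\<^sup>2 = y0 * b\<^sup>2"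
  using assms by (simp add: norm_B_def set_lebesgue_integral_def)

definition u_state :: "real \<Rightarrow> real \<Rightarrow> real \<Rightarrow> real \<Rightarrow> real \<times> real \<Rightarrow> real" where
  "u_state x0 g q b = (\<lambda>(x, y). - (1/2) * g * x\<^sup>2 + (g * x0 - q) * x + b)"

text \<open>The state solves $-\Delta u = g$ with $u = b$ on $\Gamma_1$, flux $-\partial u/\partial n = q$ on
  $x = x_0$ and zero flux on $y = 0$ and $y = y_0$.\<close>

lemma u_state_solves:
  fixes x0 g q b :: real
  defines "u \<equiv> u_state x0 g q b"
  shows "- (deriv (deriv (\<lambda>s. u (s, y))) x + deriv (deriv (\<lambda>t. u (x, t))) y) = g"
    and "u (0, y) = b"
    and "- deriv (\<lambda>s. u (s, y)) x0 = q"
    and "deriv (\<lambda>t. u (x, t)) y = 0"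
proof -
  have "((\<lambda>s. u (s, y)) has_real_derivative g * x0 - q - g * s) (at s)" for s y
    unfolding u_def u_state_def by (auto intro!: derivative_eq_intros)
  then have dx: "deriv (\<lambda>s. u (s, y)) = (\<lambda>s. g * x0 - q - g * s)" for y
    by (intro ext DERIV_imp_deriv)
  have dy: "deriv (\<lambda>t. u (x, t)) = (\<lambda>_. 0)" for x
    by (simp add: u_def u_state_def fun_eq_iff)
  have "((\<lambda>s. g * x0 - q - g * s) has_real_derivative - g) (at x)"
    by (auto intro!: derivative_eq_intros)
  then have dxx: "deriv (\<lambda>s. g * x0 - q - g * s) x = - g"
    by (rule DERIV_imp_deriv)
  show "- (deriv (deriv (\<lambda>s. u (s, y))) x + deriv (deriv (\<lambda>t. u (x, t))) y) = g"
    by (simp only: dx dy dxx) simp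
  show "u (0, y) = b" by (simp add: u_def u_state_def)
  show "- deriv (\<lambda>s. u (s, y)) x0 = q" by (simp add: dx)
  show "deriv (\<lambda>t. u (x, t)) y = 0" by (simp add: dy)
qed

definition node :: "real \<Rightarrow> nat \<Rightarrow> nat \<Rightarrow> real" where
  "node x0 n i = (real i - 1) * (x0 / real n)"

text \<open>The pieces agree at shared nodes, so selecting the least admissible index is immaterial,
  see \<open>u_discrete_piece\<close>.\<close>

definition u_discrete ::
  "real \<Rightarrow> real \<Rightarrow> real \<Rightarrow> nat \<Rightarrow> real \<Rightarrow> real \<times> real \<Rightarrow> real" where
  "u_discrete x0 g q n b = (\<lambda>(x, y).
     let h = x0 / real n;
         i = (LEAST i. i \<in> {1..n} \<and> x \<in> {node x0 n i..node x0 n (i + 1)})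
     in (g * x0 - q - h * g * real i) * x + h\<^sup>2 * g * (real i * (real i - 1) / 2) + b)"

lemma u_discrete_piece:
  assumes "x0 > 0" "i \<in> {1..n}" "x \<in> {node x0 n i..node x0 n (i + 1)}"
  shows "u_discrete x0 g q n b (x, y) =
    (g * x0 - q - (x0 / real n) * g * real i) * x
      + (x0 / real n)\<^sup>2 * g * (real i * (real i - 1) / 2) + b"
proof -
  define h where "h = x0 / real n"
  define P where "P j \<longleftrightarrow> j \<in> {1..n} \<and> x \<in> {node x0 n j..node x0 n (j + 1)}" for j
  define k where "k = (LEAST j. P j)"
  have h: "h > 0" using assms by (simp add: h_def)
  have Pi: "P i" using assms by (simp add: P_def)
  have Pk: "P k" unfolding k_def using Pi by (rule LeastI)
  have "k \<le> i" unfolding k_def using Pi by (rule Least_le)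
  have "(real i - 1) * h \<le> x" "x \<le> real k * h"
    using Pi Pk by (simp_all add: P_def node_def h_def)
  then have "(real i - 1) * h \<le> real k * h" by linarith
  then have "real i - 1 \<le> real k" using h by (simp add: mult_le_cancel_right)
  then have "i = k \<or> i = k + 1" using \<open>k \<le> i\<close> by linarith
  moreover have "x = real k * h" if "i = k + 1"
    using that \<open>(real i - 1) * h \<le> x\<close> \<open>x \<le> real k * h\<close> by simp
  ultimately have "(g * x0 - q - h * g * real k) * x + h\<^sup>2 * g * (real k * (real k - 1) / 2) + b
      = (g * x0 - q - h * g * real i) * x + h\<^sup>2 * g * (real i * (real i - 1) / 2) + b"
    by (elim disjE) (simp_all add: field_simps power2_eq_square)
  then show ?thesis
    by (simp add: u_discrete_def Let_def h_def k_def P_def)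
qed

definition J3 :: "real \<Rightarrow> real \<Rightarrow> real \<Rightarrow> real \<Rightarrow> real \<Rightarrow> real \<Rightarrow> real \<Rightarrow> real" where
  "J3 x0 y0 g q zd M3 b =
     (1/2) * (norm_H x0 y0 (\<lambda>p. u_state x0 g q b p - zd))\<^sup>2
     + (M3/2) * (norm_B y0 (\<lambda>_. b))\<^sup>2"

definition J3_discrete ::
  "real \<Rightarrow> real \<Rightarrow> real \<Rightarrow> real \<Rightarrow> real \<Rightarrow> real \<Rightarrow> nat \<Rightarrow> real \<Rightarrow> real" where
  "J3_discrete x0 y0 g q zd M3 n b =
     (1/2) * (norm_H x0 y0 (\<lambda>p. u_discrete x0 g q n b p - zd))\<^sup>2
     + (M3/2) * (norm_B y0 (\<lambda>_. b))\<^sup>2"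

text \<open>A definite description: it carries information only where the minimizer over
  $\mathbb{R}$ exists and is unique.\<close>

definition minimizer :: "(real \<Rightarrow> real) \<Rightarrow> real" where
  "minimizer J = (THE b. is_arg_min J (\<lambda>_. True) b)"

end

theory Submission
  imports Defs "HOL-Real_Asymp.Real_Asymp"
begin

text \<open>Both states depend only on \<open>x\<close> and are translated by the control, so with
  \<open>f(x) = u\<^sub>0(x) - z\<^sub>d\<close> each cost is the quadratic polynomial
  \<open>y\<^sub>0/2 \<cdot> ((x\<^sub>0 + M\<^sub>3) b\<^sup>2 + 2 I b + A)\<close> in \<open>b\<close>, where \<open>I = \<integral> f\<close> and
  \<open>A = \<integral> f\<^sup>2\<close> over \<open>[0, x\<^sub>0]\<close> (\<open>cost_quadratic\<close>). Hence the minimizer is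
  \<open>- I / (x\<^sub>0 + M\<^sub>3)\<close> and the minimum \<open>y\<^sub>0/2 \<cdot> (A - I\<^sup>2 / (x\<^sub>0 + M\<^sub>3))\<close>, and everything reduces
  to comparing the moments \<open>I\<close> and \<open>A\<close> of the two problems.

  The comparison rests on one identity (\<open>defect_cell\<close>): on the cell from \<open>kh\<close> to \<open>(k+1)h\<close> the
  discrete state differs from the exact one by
  \<open>- ghx/2 - (g/2) (x - kh) ((k+1)h - x)\<close>. The first term is a linear drift: the discrete
  flux condition imposes the slope \<open>- q\<close> on the whole last cell instead of at its end, which shifts all
  slopes by \<open>- gh/2\<close> relative to the chords of the exact state. It accumulates over \<open>[0, x\<^sub>0]\<close> and produces the whole first order error.
  The second is the error of linear interpolation of a parabola; it is \<open>O(h\<^sup>2)\<close> and each cell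
  contributes \<open>- g h\<^sup>3/12\<close> to its integral. Integrating gives
  \<open>I\<^sub>h = I - g x\<^sub>0\<^sup>2 h/4 - g x\<^sub>0 h\<^sup>2/12\<close> exactly, which is the formula for the discrete minimizer.
  For the second moment, \<open>A\<^sub>h = A - g h \<integral> x f + O(h\<^sup>2)\<close> is enough (\<open>mismatch_moments\<close>):
  the minimal costs then differ by \<open>L h + O(h\<^sup>2)\<close> with
  \<open>L = y\<^sub>0/2 \<cdot> (g x\<^sub>0\<^sup>2 I / (2 (x\<^sub>0 + M\<^sub>3)) - g \<integral> x f)\<close>, and taking absolute values
  replaces \<open>L\<close> by \<open>|L|\<close>.\<close>

section \<open>Quadratic costs and their minimizers\<close>

lemma minimizer_quadratic:
  fixes J :: "real \<Rightarrow> real"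
  assumes J: "\<And>b. J b = c * (\<alpha> * b\<^sup>2 + 2 * \<beta> * b + \<gamma>)" and "\<alpha> > 0" "c > 0"
  shows "minimizer J = - \<beta> / \<alpha>" and "J (minimizer J) = c * (\<gamma> - \<beta>\<^sup>2 / \<alpha>)"
proof -
  have square: "J b = c * \<alpha> * (b + \<beta> / \<alpha>)\<^sup>2 + c * (\<gamma> - \<beta>\<^sup>2 / \<alpha>)" for b
    using \<open>\<alpha> > 0\<close> by (simp add: J field_simps power2_eq_square)
  have pos: "c * \<alpha> > 0" using assms by simp
  have least: "J (- \<beta> / \<alpha>) \<le> J b" for b
    using pos by (simp add: square)
  have strict: "J (- \<beta> / \<alpha>) < J b" if "b \<noteq> - \<beta> / \<alpha>" for b
  proof -
    have "b + \<beta> / \<alpha> \<noteq> 0" using that by (simp add: add_eq_0_iff2)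
    then have "c * \<alpha> * (b + \<beta> / \<alpha>)\<^sup>2 > 0" using pos by simp
    then show ?thesis by (simp add: square)
  qed
  show m: "minimizer J = - \<beta> / \<alpha>"
    unfolding minimizer_def is_arg_min_def
  proof (rule the_equality)
    show "True \<and> \<not> (\<exists>y. True \<and> J y < J (- \<beta> / \<alpha>))"
      using least by (auto simp: not_less)
    show "b = - \<beta> / \<alpha>" if "True \<and> \<not> (\<exists>y. True \<and> J y < J b)" for b
      using that strict by blast
  qed
  show "J (minimizer J) = c * (\<gamma> - \<beta>\<^sup>2 / \<alpha>)"
    unfolding m by (simp add: square)
qed

lemma integral_Omega_fst:
  fixes f :: "real \<Rightarrow> real"
  assumes f: "continuous_on {0..x0} f" and "y0 > 0"
  shows "(LINT p:Omega x0 y0|lborel. f (fst p)) = y0 * integral {0..x0} f"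
proof -
  define F where "F = (\<lambda>x. indicator {0<..<x0} x * f x)"
  define Y where "Y = (indicator {0<..<y0} :: real \<Rightarrow> real)"
  have "set_integrable lborel {0..x0} f"
    by (rule borel_integrable_atLeastAtMost'[OF f])
  then have set_int: "set_integrable lborel {0<..<x0} f"
    by (rule set_integrable_subset) auto
  then have intF: "integrable lborel F"
    by (simp add: set_integrable_def F_def)
  have intF_eq: "integral\<^sup>L lborel F = integral {0..x0} f"
    using set_borel_integral_eq_integral(2)[OF set_int]
    by (simp add: set_lebesgue_integral_def F_def integral_open_interval_real)
  have [measurable]: "F \<in> borel_measurable borel"
    using intF by auto
  have [measurable]: "Y \<in> borel_measurable borel"
    by (simp add: Y_def)
  have intY: "integrable lborel Y"
    unfolding Y_def using \<open>y0 > 0\<close> by (intro integrable_real_indicator) auto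
  have intY_eq: "integral\<^sup>L lborel Y = y0"
    using \<open>y0 > 0\<close> by (simp add: Y_def)
  have int: "integrable (lborel \<Otimes>\<^sub>M lborel) (\<lambda>(x, y). F x * Y y)"
  proof (rule lborel_pair.Fubini_integrable)
    show "(\<lambda>(x, y). F x * Y y) \<in> borel_measurable (lborel \<Otimes>\<^sub>M lborel)"
      by measurable
    show "integrable lborel (\<lambda>x. LINT y|lborel. norm (case (x, y) of (x, y) \<Rightarrow> F x * Y y))"
      using intF by (simp add: abs_mult)
    show "AE x in lborel. integrable lborel (\<lambda>y. case (x, y) of (x, y) \<Rightarrow> F x * Y y)"
      using intY by simp
  qed
  have "(LINT p:Omega x0 y0|lborel. f (fst p)) = (LINT p|(lborel \<Otimes>\<^sub>M lborel). (\<lambda>(x, y). F x * Y y) p)"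
    unfolding set_lebesgue_integral_def lborel_prod
    by (rule Bochner_Integration.integral_cong)
       (auto simp: Omega_def F_def Y_def indicator_def)
  also have "\<dots> = (LINT x|lborel. LINT y|lborel. F x * Y y)"
    using lborel_pair.integral_fst'[OF int] by simp
  also have "\<dots> = y0 * integral {0..x0} f"
    by (simp add: intY_eq intF_eq)
  finally show ?thesis .
qed

text \<open>The regularisation enters only through \<open>norm_B_const\<close>, which is why it merely adds \<open>M\<close> to
  the leading coefficient \<open>x\<^sub>0\<close> coming from \<open>\<integral> b\<^sup>2\<close>.\<close>

lemma cost_quadratic:
  fixes f :: "real \<Rightarrow> real"
  assumes f: "continuous_on {0..x0} f" and "x0 > 0" "y0 > 0"
  shows "(1/2) * (norm_H x0 y0 (\<lambda>p. f (fst p) + b))\<^sup>2 + (M/2) * (norm_B y0 (\<lambda>_. b))\<^sup>2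
    = y0 / 2 * ((x0 + M) * b\<^sup>2 + 2 * integral {0..x0} f * b + integral {0..x0} (\<lambda>x. (f x)\<^sup>2))"
proof -
  have "continuous_on {0..x0} (\<lambda>x. (f x + b)\<^sup>2)"
    by (intro continuous_intros f)
  then have eq: "(LINT p:Omega x0 y0|lborel. (f (fst p) + b)\<^sup>2) = y0 * integral {0..x0} (\<lambda>x. (f x + b)\<^sup>2)"
    using integral_Omega_fst[of x0 "\<lambda>x. (f x + b)\<^sup>2"] \<open>y0 > 0\<close> by simp
  have "((\<lambda>x. (f x)\<^sup>2 + 2 * b * f x + b\<^sup>2) has_integral
      (integral {0..x0} (\<lambda>x. (f x)\<^sup>2) + 2 * b * integral {0..x0} f + x0 * b\<^sup>2)) {0..x0}"
    using \<open>x0 > 0\<close> has_integral_const_real[of "b\<^sup>2" 0 x0]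
    by (intro has_integral_add has_integral_mult_right integrable_integral
        integrable_continuous_interval continuous_intros f) auto
  then have "integral {0..x0} (\<lambda>x. (f x + b)\<^sup>2)
      = integral {0..x0} (\<lambda>x. (f x)\<^sup>2) + 2 * b * integral {0..x0} f + x0 * b\<^sup>2"
    by (intro integral_unique) (simp add: power2_sum algebra_simps)
  moreover have "(norm_H x0 y0 (\<lambda>p. f (fst p) + b))\<^sup>2 = y0 * integral {0..x0} (\<lambda>x. (f x + b)\<^sup>2)"
  proof -
    have "integral {0..x0} (\<lambda>x. (f x + b)\<^sup>2) \<ge> 0"
      by (rule Henstock_Kurzweil_Integration.integral_nonneg)
         (auto intro!: integrable_continuous_interval continuous_intros f)
    then show ?thesis
      using \<open>y0 > 0\<close> by (simp add: norm_H_def eq)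
  qed
  ultimately show ?thesis
    by (simp add: norm_B_const[OF \<open>y0 > 0\<close>] algebra_simps)
qed

section \<open>The discretisation error\<close>

lemma u_state_shift: "u_state x0 g q b p = u_state x0 g q 0 (fst p, 0) + b"
  by (simp add: u_state_def case_prod_beta)

lemma u_discrete_shift: "u_discrete x0 g q n b p = u_discrete x0 g q n 0 (fst p, 0) + b"
  by (simp add: u_discrete_def Let_def case_prod_beta)

text \<open>The discretisation error after its linear drift \<open>- ghx/2\<close> is removed; by \<open>defect_cell\<close> it
  vanishes at every node.\<close>

definition defect :: "real \<Rightarrow> real \<Rightarrow> real \<Rightarrow> nat \<Rightarrow> real \<Rightarrow> real" where
  "defect x0 g q n x =
     u_discrete x0 g q n 0 (x, 0) - u_state x0 g q 0 (x, 0) + g * (x0 / real n) * x / 2"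

text \<open>The drift is exactly the discretisation error at the nodes. Between two nodes the discrete state
  is affine, while the exact one is a parabola with second derivative \<open>- g\<close>; so the difference that
  remains is the parabola with second derivative \<open>g\<close> and zeros at the two ends of the cell.\<close>

lemma defect_cell:
  assumes "x0 > 0" "k < n" and h: "h = x0 / real n" and x: "x \<in> {real k * h..real (Suc k) * h}"
  shows "defect x0 g q n x = - (g/2) * ((x - real k * h) * (real (Suc k) * h - x))"
proof -
  have "u_discrete x0 g q n 0 (x, 0) = (g * x0 - q - h * g * real (Suc k)) * x
      + h\<^sup>2 * g * (real (Suc k) * (real (Suc k) - 1) / 2) + 0"
    \<comment> \<open>the cell that starts at \<open>kh\<close> carries the index \<open>k + 1\<close>, since the nodes are numbered from 1\<close>
    unfolding h using assms by (intro u_discrete_piece) (auto simp: node_def add_ac)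
  then show ?thesis
    unfolding defect_def h[symmetric]
    by (simp add: u_state_def field_simps power2_eq_square)
qed

lemma cells_cover:
  assumes "x0 > 0" "n \<ge> 1" "h = x0 / real n"
  shows "{0..x0} = (\<Union>k<n. {real k * h..real (Suc k) * h})"
proof -
  have "{0..real m * h} = (\<Union>k<m. {real k * h..real (Suc k) * h})" if "m \<ge> 1" for m
    using that
  proof (induction m rule: nat_induct_at_least)
    case base
    then show ?case by (auto simp: lessThan_Suc)
  next
    case (Suc m)
    have "h \<ge> 0" using assms by simp
    then have "{0..real (Suc m) * h} = {0..real m * h} \<union> {real m * h..real (Suc m) * h}"
      by (intro ivl_disj_un_two_touch(4)[symmetric] mult_right_mono) auto
    then show ?case by (simp add: Suc.IH lessThan_Suc Un_commute)
  qed
  from this[of n] show ?thesis using assms by simp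
qed

lemma continuous_defect:
  assumes "x0 > 0" "n \<ge> 1"
  shows "continuous_on {0..x0} (defect x0 g q n)"
proof -
  define h where "h = x0 / real n"
  have "continuous_on {real k * h..real (Suc k) * h} (defect x0 g q n)" if "k < n" for k
  proof (subst continuous_on_cong[OF refl])
    show "defect x0 g q n x = - (g/2) * ((x - real k * h) * (real (Suc k) * h - x))"
      if "x \<in> {real k * h..real (Suc k) * h}" for x
      using that assms \<open>k < n\<close> by (intro defect_cell[OF _ _ h_def])
  qed (intro continuous_intros)
  then show ?thesis
    unfolding cells_cover[OF assms h_def]
    by (intro continuous_on_closed_Union) auto
qed

lemma continuous_u_state: "continuous_on S (\<lambda>x. u_state x0 g q b (x, 0))"
  unfolding u_state_def by (auto intro!: continuous_intros)

lemma continuous_u_discrete: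
  assumes "x0 > 0" "n \<ge> 1"
  shows "continuous_on {0..x0} (\<lambda>x. u_discrete x0 g q n 0 (x, 0))"
proof -
  have "(\<lambda>x. u_discrete x0 g q n 0 (x, 0))
      = (\<lambda>x. defect x0 g q n x + u_state x0 g q 0 (x, 0) - g * (x0 / real n) * x / 2)"
    by (simp add: defect_def)
  then show ?thesis
    using assms by (simp only:) (intro continuous_intros continuous_defect continuous_u_state, auto)
qed

lemma defect_le:
  assumes "x0 > 0" "n \<ge> 1" "x \<in> {0..x0}"
  shows "\<bar>defect x0 g q n x\<bar> \<le> \<bar>g\<bar> * (x0 / real n)\<^sup>2"
proof -
  define h where "h = x0 / real n"
  obtain k where "k < n" and x: "x \<in> {real k * h..real (Suc k) * h}"
    using assms cells_cover[OF assms(1,2) h_def] by auto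
  define s t where "s = x - real k * h" and "t = real (Suc k) * h - x"
  have st: "0 \<le> s" "0 \<le> t" "s \<le> h" "t \<le> h"
    using x by (auto simp: s_def t_def algebra_simps)
  have "\<bar>defect x0 g q n x\<bar> = \<bar>g\<bar> / 2 * (s * t)"
    using defect_cell[OF assms(1) \<open>k < n\<close> h_def x] st by (simp add: s_def t_def abs_mult)
  also have "\<dots> \<le> \<bar>g\<bar> * (h * h)"
    using st by (intro mult_mono) auto
  finally show ?thesis by (simp add: h_def power2_eq_square)
qed

lemma defect_has_integral:
  assumes "x0 > 0" "n \<ge> 1"
  shows "(defect x0 g q n has_integral - g * x0 * (x0 / real n)\<^sup>2 / 12) {0..x0}"
proof -
  define h where "h = x0 / real n"
  have h: "h > 0" using assms by (simp add: h_def)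
  have cell: "(defect x0 g q n has_integral - g * h ^ 3 / 12) {real k * h..real (Suc k) * h}"
    if "k < n" for k
  proof -
    let ?P = "\<lambda>x. - (g/2) * (h * (x - real k * h)\<^sup>2 / 2 - (x - real k * h) ^ 3 / 3)"
    have "((\<lambda>x. - (g/2) * ((x - real k * h) * (real (Suc k) * h - x))) has_integral
        ?P (real (Suc k) * h) - ?P (real k * h)) {real k * h..real (Suc k) * h}"
    proof (rule fundamental_theorem_of_calculus)
      show "real k * h \<le> real (Suc k) * h" using h by simp
      show "(?P has_vector_derivative - (g/2) * ((x - real k * h) * (real (Suc k) * h - x)))
          (at x within {real k * h..real (Suc k) * h})" for x
        unfolding has_real_derivative_iff_has_vector_derivative[symmetric]
        by (auto intro!: derivative_eq_intros simp: field_simps power2_eq_square)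
    qed
    also have "?P (real (Suc k) * h) - ?P (real k * h) = - g * h ^ 3 / 12"
      by (simp add: algebra_simps power2_eq_square power3_eq_cube)
    finally show ?thesis
      by (rule has_integral_eq[rotated])
         (use defect_cell[OF assms(1) that h_def] in simp)
  qed
  have "(defect x0 g q n has_integral real m * (- g * h ^ 3 / 12)) {0..real m * h}" if "m \<le> n" for m
    using that
  proof (induction m)
    case 0
    then show ?case by (simp add: has_integral_refl)
  next
    case (Suc m)
    then have "(defect x0 g q n has_integral real m * (- g * h ^ 3 / 12) + - g * h ^ 3 / 12)
        {0..real (Suc m) * h}"
      using h by (intro has_integral_combine[of 0 "real m * h"] cell) auto
    moreover have "real m * (- g * h ^ 3 / 12) + - g * h ^ 3 / 12 = real (Suc m) * (- g * h ^ 3 / 12)"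
      by (simp add: field_simps)
    ultimately show ?case by (simp only:)
  qed
  from this[of n] show ?thesis
    using assms by (simp add: h_def power2_eq_square power3_eq_cube mult.assoc)
qed

section \<open>Comparison of the moments and of the minima\<close>

text \<open>Turns the explicit estimates in \<open>h = a/n\<close> into the little-o statements.\<close>

lemma smallo_of_quadratic_bound:
  fixes f :: "nat \<Rightarrow> real"
  assumes "\<And>n. n \<ge> 1 \<Longrightarrow> \<bar>f n\<bar> \<le> C * (a / real n)\<^sup>2"
  shows "f \<in> o(\<lambda>n. a / real n)"
proof -
  have "eventually (\<lambda>n. norm (f n) \<le> C * norm ((a / real n)\<^sup>2)) sequentially"
    using eventually_ge_at_top[of 1] by eventually_elim (use assms in simp)
  then have "f \<in> O(\<lambda>n. (a / real n)\<^sup>2)"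
    by (rule bigoI)
  also have "(\<lambda>n. (a / real n)\<^sup>2) \<in> o(\<lambda>n. a / real n)"
  proof (cases "a = 0")
    case False
    then show ?thesis by real_asymp
  qed auto
  finally show ?thesis .
qed

text \<open>The two moments of the mismatch between state and target. The first is linear in the
  discretisation error, so the integrals of drift and defect give it exactly. For the second, with
  \<open>e\<close> the discretisation error and \<open>d\<close> the defect,
  \<open>(w + e)\<^sup>2 - w\<^sup>2 + g h x w = 2 w d + e\<^sup>2\<close>, and both terms are \<open>O(h\<^sup>2)\<close> uniformly on
  \<open>[0, x\<^sub>0]\<close>.\<close>

lemma mismatch_moments:
  fixes x0 g q zd :: real
  assumes "x0 > 0"
  defines "w \<equiv> (\<lambda>x. u_state x0 g q 0 (x, 0) - zd)"
    and "wh \<equiv> (\<lambda>n x. u_discrete x0 g q n 0 (x, 0) - zd)"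
  shows "n \<ge> 1 \<Longrightarrow> integral {0..x0} (wh n)
      = integral {0..x0} w - g * x0\<^sup>2 * (x0 / real n) / 4 - g * x0 * (x0 / real n)\<^sup>2 / 12"
    and "\<exists>C. \<forall>n\<ge>1. \<bar>integral {0..x0} (\<lambda>x. (wh n x)\<^sup>2) - integral {0..x0} (\<lambda>x. (w x)\<^sup>2)
      + g * (x0 / real n) * integral {0..x0} (\<lambda>x. x * w x)\<bar> \<le> C * (x0 / real n)\<^sup>2"
proof -
  have cw: "continuous_on {0..x0} w"
    unfolding w_def by (intro continuous_intros continuous_u_state)
  have wh: "wh n x = w x - g * (x0 / real n) * x / 2 + defect x0 g q n x" for n x
    by (simp add: wh_def w_def defect_def)
  show "integral {0..x0} (wh n)
      = integral {0..x0} w - g * x0\<^sup>2 * (x0 / real n) / 4 - g * x0 * (x0 / real n)\<^sup>2 / 12"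
    if n: "n \<ge> 1"
  proof -
    have id: "((\<lambda>x. x) has_integral x0\<^sup>2 / 2) {0..x0}"
      using ident_has_integral[of 0 x0] \<open>x0 > 0\<close> by simp
    have "((\<lambda>x. w x - g * (x0 / real n) / 2 * x + defect x0 g q n x) has_integral
        (integral {0..x0} w - g * (x0 / real n) / 2 * (x0\<^sup>2 / 2) + - g * x0 * (x0 / real n)\<^sup>2 / 12))
        {0..x0}"
      by (intro has_integral_add has_integral_diff has_integral_mult_right id
          defect_has_integral \<open>x0 > 0\<close> n integrable_integral integrable_continuous_interval cw)
    then have "(wh n has_integral
        (integral {0..x0} w - g * (x0 / real n) / 2 * (x0\<^sup>2 / 2) + - g * x0 * (x0 / real n)\<^sup>2 / 12))
        {0..x0}"
      by (rule has_integral_eq[rotated]) (simp add: wh)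
    then show ?thesis
      by (simp add: integral_unique mult_ac)
  qed
  obtain W where W: "\<And>x. x \<in> {0..x0} \<Longrightarrow> \<bar>w x\<bar> \<le> W"
  proof -
    have "bounded (w ` {0..x0})"
      by (intro compact_imp_bounded compact_continuous_image cw compact_Icc)
    then obtain W where "\<forall>x\<in>{0..x0}. \<bar>w x\<bar> \<le> W"
      by (auto simp: bounded_iff)
    then show thesis using that by blast
  qed
  \<comment> \<open>\<open>2 W |g|\<close> bounds the cross term; the square comes from bounding the
    discretisation error by a multiple of \<open>h\<close>, with \<open>h\<^sup>2 \<le> x\<^sub>0 h\<close> used on the defect\<close>
  define C where "C = 2 * W * \<bar>g\<bar> + (\<bar>g\<bar> * x0 / 2 + \<bar>g\<bar> * x0)\<^sup>2"
  show "\<exists>C. \<forall>n\<ge>1. \<bar>integral {0..x0} (\<lambda>x. (wh n x)\<^sup>2) - integral {0..x0} (\<lambda>x. (w x)\<^sup>2)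
      + g * (x0 / real n) * integral {0..x0} (\<lambda>x. x * w x)\<bar> \<le> C * (x0 / real n)\<^sup>2"
  proof (intro exI allI impI)
    fix n :: nat assume n: "n \<ge> 1"
    define h where "h = x0 / real n"
    have h: "h > 0" "h \<le> x0"
      using \<open>x0 > 0\<close> n by (simp_all add: h_def field_simps)
    let ?d = "defect x0 g q n"
    let ?r = "\<lambda>x. (wh n x)\<^sup>2 - (w x)\<^sup>2 + g * h * (x * w x)"
    have cwh: "continuous_on {0..x0} (wh n)"
      unfolding wh_def by (intro continuous_intros continuous_u_discrete \<open>x0 > 0\<close> n)
    have r: "(?r has_integral (integral {0..x0} (\<lambda>x. (wh n x)\<^sup>2) - integral {0..x0} (\<lambda>x. (w x)\<^sup>2)
        + g * h * integral {0..x0} (\<lambda>x. x * w x))) {0..x0}"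
      by (intro has_integral_add has_integral_diff has_integral_mult_right integrable_integral
          integrable_continuous_interval continuous_intros cw cwh)
    have "\<bar>?r x\<bar> \<le> C * h\<^sup>2" if x: "x \<in> {0..x0}" for x
    proof -
      have d: "\<bar>?d x\<bar> \<le> \<bar>g\<bar> * h\<^sup>2"
        using defect_le[OF \<open>x0 > 0\<close> n x] by (simp add: h_def)
      define e where "e = ?d x - g * h * x / 2"
      have "\<bar>e\<bar> \<le> \<bar>?d x\<bar> + \<bar>g * h * x / 2\<bar>"
        unfolding e_def by (rule abs_triangle_ineq4)
      also have "\<dots> \<le> \<bar>g\<bar> * x0 * h + \<bar>g\<bar> * x0 * h / 2"
      proof (intro add_mono)
        have "\<bar>g\<bar> * h\<^sup>2 \<le> \<bar>g\<bar> * x0 * h"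
          using h by (simp add: power2_eq_square mult_mono mult.assoc)
        then show "\<bar>?d x\<bar> \<le> \<bar>g\<bar> * x0 * h" using d by linarith
        have "\<bar>g * h * x / 2\<bar> = \<bar>g\<bar> * h * x / 2"
          using h x by (simp add: abs_mult)
        also have "\<dots> \<le> \<bar>g\<bar> * h * x0 / 2"
          using h x by (intro divide_right_mono mult_left_mono) auto
        finally show "\<bar>g * h * x / 2\<bar> \<le> \<bar>g\<bar> * x0 * h / 2" by (simp add: mult_ac)
      qed
      finally have "\<bar>e\<bar> \<le> (\<bar>g\<bar> * x0 / 2 + \<bar>g\<bar> * x0) * h"
        by (simp add: algebra_simps)
      then have "\<bar>e\<bar>\<^sup>2 \<le> ((\<bar>g\<bar> * x0 / 2 + \<bar>g\<bar> * x0) * h)\<^sup>2"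
        by (intro power_mono) auto
      then have e2: "e\<^sup>2 \<le> (\<bar>g\<bar> * x0 / 2 + \<bar>g\<bar> * x0)\<^sup>2 * h\<^sup>2"
        by (simp only: power2_abs power_mult_distrib[of _ h])
      have "\<bar>w x * ?d x\<bar> \<le> W * (\<bar>g\<bar> * h\<^sup>2)"
        unfolding abs_mult using W[OF x] d by (intro mult_mono) auto
      moreover have "?r x = 2 * (w x * ?d x) + e\<^sup>2"
        by (simp add: wh e_def h_def[symmetric] power2_eq_square algebra_simps)
      moreover have "e\<^sup>2 \<ge> 0" by simp
      ultimately have "\<bar>?r x\<bar> \<le> 2 * (W * (\<bar>g\<bar> * h\<^sup>2)) + (\<bar>g\<bar> * x0 / 2 + \<bar>g\<bar> * x0)\<^sup>2 * h\<^sup>2"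
        using e2 by linarith
      then show ?thesis by (simp add: C_def algebra_simps)
    qed
    moreover from this[of 0] have "0 \<le> C * h\<^sup>2"
      using \<open>x0 > 0\<close> by (meson abs_ge_zero atLeastAtMost_iff less_imp_le order_refl order_trans)
    ultimately have "norm (integral {0..x0} (\<lambda>x. (wh n x)\<^sup>2) - integral {0..x0} (\<lambda>x. (w x)\<^sup>2)
        + g * h * integral {0..x0} (\<lambda>x. x * w x)) \<le> C * h\<^sup>2 * measure lborel (cbox 0 x0)"
      using r by (intro has_integral_bound[where f = ?r]) auto
    then show "\<bar>integral {0..x0} (\<lambda>x. (wh n x)\<^sup>2) - integral {0..x0} (\<lambda>x. (w x)\<^sup>2)
        + g * (x0 / real n) * integral {0..x0} (\<lambda>x. x * w x)\<bar> \<le> (C * x0) * (x0 / real n)\<^sup>2"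
      using \<open>x0 > 0\<close> by (simp add: h_def mult_ac)
  qed
qed

theorem lemma16:
  fixes x0 y0 g q zd M3 bop :: real and bh :: "nat \<Rightarrow> real"
  assumes "x0 > 0" and "y0 > 0" and "M3 > 0"
  defines "bop \<equiv> minimizer (J3 x0 y0 g q zd M3)"
    and "bh \<equiv> (\<lambda>n. minimizer (J3_discrete x0 y0 g q zd M3 n))"
  shows "(\<forall>n\<ge>1. let h = x0 / real n; E1 = 1 / (4 * (1 + M3 / x0)) in
            bh n = bop + E1 * g * x0 * h * (1 + h / (3 * x0)))
    \<and> (\<exists>C13 C14 :: real.
          (\<lambda>n. \<bar>bh n - bop\<bar> - C13 * (x0 / real n)) \<in> o(\<lambda>n. x0 / real n)
        \<and> (\<lambda>n. \<bar>J3_discrete x0 y0 g q zd M3 n (bh n) - J3 x0 y0 g q zd M3 bop\<bar>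
              - C14 * (x0 / real n)) \<in> o(\<lambda>n. x0 / real n))"
proof -
  define w where "w = (\<lambda>x. u_state x0 g q 0 (x, 0) - zd)"
  define wh where "wh = (\<lambda>n x. u_discrete x0 g q n 0 (x, 0) - zd)"
  define I where "I = integral {0..x0} w"
  define A where "A = integral {0..x0} (\<lambda>x. (w x)\<^sup>2)"
  define K where "K = integral {0..x0} (\<lambda>x. x * w x)"
  define Ih where "Ih n = integral {0..x0} (wh n)" for n
  define Ah where "Ah n = integral {0..x0} (\<lambda>x. (wh n x)\<^sup>2)" for n
  define \<alpha> where "\<alpha> = x0 + M3"
  have \<alpha>: "\<alpha> > 0" using assms by (simp add: \<alpha>_def)
  have cw: "continuous_on {0..x0} w"
    unfolding w_def by (intro continuous_intros continuous_u_state)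
  have cwh: "continuous_on {0..x0} (wh n)" if "n \<ge> 1" for n
    unfolding wh_def by (intro continuous_intros continuous_u_discrete \<open>x0 > 0\<close> that)
  have J: "J3 x0 y0 g q zd M3 b = y0 / 2 * (\<alpha> * b\<^sup>2 + 2 * I * b + A)" for b
  proof -
    have "(\<lambda>p. u_state x0 g q b p - zd) = (\<lambda>p. w (fst p) + b)"
      using u_state_shift[of x0 g q b] by (auto simp: w_def)
    then show ?thesis
      unfolding J3_def I_def A_def \<alpha>_def using cost_quadratic[OF cw assms(1,2)] by simp
  qed
  have Jh: "J3_discrete x0 y0 g q zd M3 n b = y0 / 2 * (\<alpha> * b\<^sup>2 + 2 * Ih n * b + Ah n)"
    if "n \<ge> 1" for n b
  proof -
    have "(\<lambda>p. u_discrete x0 g q n b p - zd) = (\<lambda>p. wh n (fst p) + b)"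
      using u_discrete_shift[of x0 g q n b] by (auto simp: wh_def)
    then show ?thesis
      unfolding J3_discrete_def Ih_def Ah_def \<alpha>_def
      using cost_quadratic[OF cwh[OF that] assms(1,2)] by simp
  qed
  have y: "y0 / 2 > 0" using \<open>y0 > 0\<close> by simp
  note min = minimizer_quadratic[OF J \<alpha> y, folded bop_def]
  note minh = minimizer_quadratic[OF Jh \<alpha> y]
  have Ih: "Ih n = I - g * x0\<^sup>2 * (x0 / real n) / 4 - g * x0 * (x0 / real n)\<^sup>2 / 12" if "n \<ge> 1" for n
    using mismatch_moments(1)[OF \<open>x0 > 0\<close> that, of g q zd] by (simp add: Ih_def I_def w_def wh_def)
  obtain C where C: "\<And>n. n \<ge> 1 \<Longrightarrow> \<bar>Ah n - A + g * (x0 / real n) * K\<bar> \<le> C * (x0 / real n)\<^sup>2"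
    using mismatch_moments(2)[OF \<open>x0 > 0\<close>, of g q zd]
    unfolding Ah_def A_def K_def w_def wh_def by blast
  have diff: "bh n - bop = (g * x0\<^sup>2 * (x0 / real n) / 4 + g * x0 * (x0 / real n)\<^sup>2 / 12) / \<alpha>"
    if "n \<ge> 1" for n
    unfolding bh_def minh(1)[OF that] min(1) Ih[OF that]
    by (simp add: diff_divide_distrib add_divide_distrib)
  have a: "bh n = bop + 1 / (4 * (1 + M3 / x0)) * g * x0 * h * (1 + h / (3 * x0))"
    if "n \<ge> 1" "h = x0 / real n" for n h
  proof -
    have "bh n - bop = 1 / (4 * (1 + M3 / x0)) * g * x0 * h * (1 + h / (3 * x0))"
      using \<alpha> \<open>x0 > 0\<close> unfolding diff[OF that(1)] that(2)[symmetric] \<alpha>_def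
      by (simp add: divide_simps) (simp add: algebra_simps power2_eq_square)
    then show ?thesis by simp
  qed
  have b1: "(\<lambda>n. \<bar>bh n - bop\<bar> - \<bar>g * x0\<^sup>2 / (4 * \<alpha>)\<bar> * (x0 / real n)) \<in> o(\<lambda>n. x0 / real n)"
  proof (rule smallo_of_quadratic_bound)
    fix n :: nat assume n: "n \<ge> 1"
    let ?h = "x0 / real n"
    have "\<bar>g * x0\<^sup>2 / (4 * \<alpha>)\<bar> * ?h = \<bar>g * x0\<^sup>2 / (4 * \<alpha>) * ?h\<bar>"
      using \<open>x0 > 0\<close> by (simp add: abs_mult)
    then have "\<bar>\<bar>bh n - bop\<bar> - \<bar>g * x0\<^sup>2 / (4 * \<alpha>)\<bar> * ?h\<bar> \<le> \<bar>(bh n - bop) - g * x0\<^sup>2 / (4 * \<alpha>) * ?h\<bar>"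
      using abs_triangle_ineq3 by metis
    also have "(bh n - bop) - g * x0\<^sup>2 / (4 * \<alpha>) * ?h = g * x0 / (12 * \<alpha>) * ?h\<^sup>2"
      unfolding diff[OF n] by (simp add: add_divide_distrib)
    finally show "\<bar>\<bar>bh n - bop\<bar> - \<bar>g * x0\<^sup>2 / (4 * \<alpha>)\<bar> * ?h\<bar> \<le> \<bar>g * x0 / (12 * \<alpha>)\<bar> * ?h\<^sup>2"
      by (simp add: abs_mult)
  qed
  \<comment> \<open>\<open>L\<close> collects the terms linear in \<open>h\<close> of the moment expansions inserted in the minimum
    value; \<open>\<delta>\<close> bounds \<open>(I - I\<^sub>h)/h\<close>\<close>
  define L where "L = y0 / 2 * (I * g * x0\<^sup>2 / (2 * \<alpha>) - g * K)"
  define \<delta> where "\<delta> = \<bar>g\<bar> * x0\<^sup>2 / 4 + \<bar>g\<bar> * x0\<^sup>2 / 12"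
  have b2: "(\<lambda>n. \<bar>J3_discrete x0 y0 g q zd M3 n (bh n) - J3 x0 y0 g q zd M3 bop\<bar>
      - \<bar>L\<bar> * (x0 / real n)) \<in> o(\<lambda>n. x0 / real n)"
  proof (rule smallo_of_quadratic_bound)
    fix n :: nat assume n: "n \<ge> 1"
    define h where "h = x0 / real n"
    have h: "h > 0" "h \<le> x0"
      using \<open>x0 > 0\<close> n by (simp_all add: h_def field_simps)
    define D where "D = J3_discrete x0 y0 g q zd M3 n (bh n) - J3 x0 y0 g q zd M3 bop"
    define s where "s = g * x0\<^sup>2 / 4 + g * x0 * h / 12"
    have Ih': "Ih n = I - s * h"
      unfolding Ih[OF n] by (simp add: s_def h_def power2_eq_square algebra_simps)
    have D: "D = y0 / 2 * (Ah n - (Ih n)\<^sup>2 / \<alpha>) - y0 / 2 * (A - I\<^sup>2 / \<alpha>)"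
      unfolding D_def min(2) using minh(2)[OF n] by (simp add: bh_def)
    then have rem: "D - L * h = y0 / 2 * ((Ah n - A + g * h * K) + (I * g * x0 / (6 * \<alpha>)) * h\<^sup>2 - s\<^sup>2 / \<alpha> * h\<^sup>2)"
    proof -
      have "(Ih n)\<^sup>2 / \<alpha> = I\<^sup>2 / \<alpha> - 2 * I * s * h / \<alpha> + s\<^sup>2 / \<alpha> * h\<^sup>2"
        by (simp add: Ih' power2_diff power_mult_distrib diff_divide_distrib add_divide_distrib)
      moreover have "2 * I * s * h / \<alpha> = I * g * x0\<^sup>2 / (2 * \<alpha>) * h + I * g * x0 / (6 * \<alpha>) * h\<^sup>2"
        using \<alpha> by (simp add: s_def field_simps power2_eq_square)
      ultimately have sq: "(Ih n)\<^sup>2 / \<alpha> = I\<^sup>2 / \<alpha>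
          - (I * g * x0\<^sup>2 / (2 * \<alpha>) * h + I * g * x0 / (6 * \<alpha>) * h\<^sup>2) + s\<^sup>2 / \<alpha> * h\<^sup>2"
        by simp
      show ?thesis
        unfolding D sq by (simp add: L_def algebra_simps)
    qed
    have "\<bar>s\<bar> \<le> \<delta>"
    proof -
      have "\<bar>g * x0 * h\<bar> \<le> \<bar>g\<bar> * x0\<^sup>2"
        using h \<open>x0 > 0\<close> by (simp add: abs_mult power2_eq_square mult.assoc mult_left_mono)
      moreover have "\<bar>g * x0\<^sup>2\<bar> = \<bar>g\<bar> * x0\<^sup>2" by (simp add: abs_mult)
      ultimately show ?thesis unfolding s_def \<delta>_def by linarith
    qed
    then have "s\<^sup>2 \<le> \<delta>\<^sup>2" by (rule abs_le_square_iff[THEN iffD1, OF order_trans]) auto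
    then have "s\<^sup>2 / \<alpha> * h\<^sup>2 \<le> \<delta>\<^sup>2 / \<alpha> * h\<^sup>2"
      using \<alpha> by (intro mult_right_mono divide_right_mono) auto
    moreover have "s\<^sup>2 / \<alpha> * h\<^sup>2 \<ge> 0" using \<alpha> by simp
    moreover have "\<bar>(I * g * x0 / (6 * \<alpha>)) * h\<^sup>2\<bar> = \<bar>I * g * x0 / (6 * \<alpha>)\<bar> * h\<^sup>2"
      by (simp add: abs_mult)
    moreover have "\<bar>Ah n - A + g * h * K\<bar> \<le> C * h\<^sup>2"
      using C[OF n] by (simp add: h_def)
    ultimately have "\<bar>(Ah n - A + g * h * K) + (I * g * x0 / (6 * \<alpha>)) * h\<^sup>2 - s\<^sup>2 / \<alpha> * h\<^sup>2\<bar>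
        \<le> C * h\<^sup>2 + \<bar>I * g * x0 / (6 * \<alpha>)\<bar> * h\<^sup>2 + \<delta>\<^sup>2 / \<alpha> * h\<^sup>2"
      by linarith
    then have "\<bar>D - L * h\<bar> \<le> y0 / 2 * (C * h\<^sup>2 + \<bar>I * g * x0 / (6 * \<alpha>)\<bar> * h\<^sup>2 + \<delta>\<^sup>2 / \<alpha> * h\<^sup>2)"
      unfolding rem abs_mult using y by (intro mult_mono) auto
    moreover have "\<bar>\<bar>D\<bar> - \<bar>L\<bar> * h\<bar> \<le> \<bar>D - L * h\<bar>"
      using abs_triangle_ineq3[of D "L * h"] h by (simp add: abs_mult)
    ultimately show "\<bar>\<bar>J3_discrete x0 y0 g q zd M3 n (bh n) - J3 x0 y0 g q zd M3 bop\<bar>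
        - \<bar>L\<bar> * (x0 / real n)\<bar>
        \<le> (y0 / 2 * (C + \<bar>I * g * x0 / (6 * \<alpha>)\<bar> + \<delta>\<^sup>2 / \<alpha>)) * (x0 / real n)\<^sup>2"
      unfolding D_def[symmetric] h_def[symmetric] by (simp add: algebra_simps)
  qed
  show ?thesis
    unfolding Let_def using a b1 b2 by blast
qed

end
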